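(* Let $G$ be a connected graph on $n$ vertices with average degree $d$. Then for any fixed integer $k\ge 2$ we have $\pi(G,k)=\Omega_k(d^{k-1})$.
   Context: Graphs are finite and simple; a graph with $n$ vertices and $m$ edges has average degree $d=2m/n$. The notation $\Omega_k$ is the usual asymptotic lower-bound notation in which the implied positive constant depends only on $k$. For a graph $G$ on $n$ vertices, a connected $(n_1,\dots,n_k)$-vertex partition, where $\sum_{i=1}^k n_i=n$, is a partition $V(G)=V_1\cup\dots\cup V_k$ with $|V_i|=n_i$ for all $i$ such that every $V_i$ induces a connected subgraph of $G$. For a connected graph $G$ and an integer $k\ge 2$, $\pi(G,k)$ is the number of integer $k$-tuples $(n_1,\dots,n_k)$ with $n_1\ge n_2\ge\dots\ge n_k\ge 1$ for which there exists a connected $(n_1,\dots,n_k)$-vertex partition of $G$.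
   Formalization: The formal statement adds the condition n ≥ k; for 2 ≤ n < k there are no k-tuples, so π(G,k) = 0 while d > 0 (e.g. K_2 with k = 3), and the bound with a constant depending only on k would fail. *)

theory Defs
  imports Complex_Main "HOL-Library.Disjoint_Sets" "Graph_Theory.Digraph_Component"
begin

text \<open>
  A finite simple graph is a \<^locale>\<open>pair_graph\<close>: a finite, loopless, symmetric set of pairs over a
  finite vertex set. Each undirected edge \<open>{u, v}\<close> is thus represented by the two arcs \<open>(u, v)\<close> and
  \<open>(v, u)\<close>, so edges are counted as unordered pairs. The name \<open>connected\<close> is qualified because it
  is also the name of the topological notion; the graph notion excludes the empty vertex set.
\<close>

definition edge_set :: "'a pair_pre_digraph \<Rightarrow> 'a set set" where
  "edge_set G = {{u, v} | u v. (u, v) \<in> parcs G}"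

definition average_degree :: "'a pair_pre_digraph \<Rightarrow> real" where
  "average_degree G = 2 * real (card (edge_set G)) / real (card (pverts G))"

definition has_connected_partition :: "'a pair_pre_digraph \<Rightarrow> nat list \<Rightarrow> bool" where
  "has_connected_partition G ns \<longleftrightarrow>
     sum_list ns = card (pverts G) \<and>
     (\<exists>V :: nat \<Rightarrow> 'a set.
        (\<Union>i<length ns. V i) = pverts G \<and>
        disjoint_family_on V {..<length ns} \<and>
        (\<forall>i<length ns. card (V i) = ns ! i \<and>
           Digraph_Component.connected (with_proj G \<restriction> V i)))"

definition num_partition_sizes :: "'a pair_pre_digraph \<Rightarrow> nat \<Rightarrow> nat" where
  "num_partition_sizes G k =
     card {ns :: nat list. length ns = k \<and> sorted_wrt (\<ge>) ns \<and> (\<forall>x \<in> set ns. 1 \<le> x) \<and>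
             has_connected_partition G ns}"

end

theory Submission
  imports Defs "HOL-Combinatorics.Permutations"
begin

text \<open>
  Deleting an end vertex of a longest path destroys few edges, so a graph with average degree \<open>d\<close>
  contains a path with \<open>\<Omega>(d)\<close> vertices. If the graph is connected, the vertices off the path can be
  attached one by one, which partitions the vertex set into connected sets \<open>F\<^sub>0, \<dots>, F\<^sub>L\<close>, one for each
  vertex of the path, consecutive ones being joined by an edge. Cutting this sequence at \<open>k - 1\<close>
  places gives connected partitions whose size vectors determine the cuts. There are
  \<open>\<Omega>\<^sub>k(L\<^sup>k\<^sup>-\<^sup>1)\<close> ways to cut, and at most \<open>k!\<close> size vectors agree after sorting.
\<close>

section \<open>Connectedness inside a vertex set\<close>

definition connected_in :: "'a rel \<Rightarrow> 'a set \<Rightarrow> bool" where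
  "connected_in E W \<longleftrightarrow> W \<noteq> {} \<and> (\<forall>u\<in>W. \<forall>v\<in>W. (u, v) \<in> rtrancl_on W E)"

lemma connected_in_singleton: "connected_in E {x}"
  by (auto simp: connected_in_def)

lemma connected_in_Un:
  assumes "sym E" "connected_in E A" "connected_in E B" "u \<in> A" "w \<in> B" "(u, w) \<in> E"
  shows "connected_in E (A \<union> B)"
proof -
  let ?R = "rtrancl_on (A \<union> B) E"
  have A: "(x, y) \<in> ?R" if "x \<in> A" "y \<in> A" for x y
    using that assms(2) rtrancl_on_mono[of E E A "A \<union> B" x y] by (auto simp: connected_in_def)
  have B: "(x, y) \<in> ?R" if "x \<in> B" "y \<in> B" for x y
    using that assms(3) rtrancl_on_mono[of E E B "A \<union> B" x y] by (auto simp: connected_in_def)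
  have uw: "(u, w) \<in> ?R"
    using assms(4-6) by (meson UnI1 UnI2 rtrancl_on_into_rtrancl_on rtrancl_on_refl)
  have AB: "(x, y) \<in> ?R" if "x \<in> A" "y \<in> B" for x y
    using A[OF that(1) assms(4)] uw B[OF assms(5) that(2)] by (meson rtrancl_on_trans)
  have BA: "(y, x) \<in> ?R" if "x \<in> A" "y \<in> B" for x y
    using AB[OF that] rtrancl_on_sym[OF assms(1)] by (meson symD)
  show ?thesis
    using A B AB BA assms(2) by (auto simp: connected_in_def)
qed

lemma connected_in_chain:
  assumes "sym E" "a < b" "\<And>i. i < b \<Longrightarrow> connected_in E (F i)"
    and "\<And>i. Suc i < b \<Longrightarrow> \<exists>u\<in>F i. \<exists>w\<in>F (Suc i). (u, w) \<in> E"
  shows "connected_in E (\<Union>i\<in>{a..<b}. F i)"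
  using assms(2-4)
proof (induction b)
  case 0
  then show ?case by simp
next
  case (Suc b)
  show ?case
  proof (cases "a = b")
    case True
    then show ?thesis using Suc.prems(2)[of b] by simp
  next
    case False
    then obtain j where j: "b = Suc j" "a \<le> j"
      using Suc.prems(1) by (cases b) auto
    obtain u w where uw: "u \<in> F j" "w \<in> F b" "(u, w) \<in> E"
      using Suc.prems(3)[of j] j by auto
    have "connected_in E ((\<Union>i\<in>{a..<b}. F i) \<union> F b)"
      using Suc j uw by (intro connected_in_Un[OF \<open>sym E\<close> _ _ _ uw(2,3)]) auto
    moreover have "{a..<Suc b} = insert b {a..<b}" using j by auto
    ultimately show ?thesis by (simp add: Un_commute)
  qed
qed

text \<open>\<open>Digraph_Component.connected\<close> means strong connectivity of the symmetric
  closure. Every arc with both ends in \<open>W\<close> survives in the closure of the induced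
  subgraph, so a walk inside \<open>W\<close> carries over arc by arc.\<close>

lemma connected_induce_subgraph:
  assumes "connected_in (parcs G) W"
  shows "Digraph_Component.connected (with_proj G \<restriction> W)"
proof -
  let ?H = "mk_symmetric (with_proj G \<restriction> W)"
  have "(u, v) \<in> rtrancl_on W (parcs ?H)" if "(u, v) \<in> rtrancl_on W (parcs G)" for u v
    using that
  proof (induction rule: rtrancl_on_induct)
    case base
    then show ?case by auto
  next
    case (step y z)
    then have "(y, z) \<in> parcs ?H"
      by (force simp: parcs_mk_symmetric induce_subgraph_def)
    then show ?case using step by (meson rtrancl_on_into_rtrancl_on)
  qed
  then show ?thesis
    using assms
    unfolding connected_in_def Digraph_Component.connected_def strongly_connected_def reachable_def
    by (simp add: induce_subgraph_def)
qed

section \<open>Growing connected sets one vertex at a time\<close>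

text \<open>If no arc left \<open>S\<close>, every walk starting in \<open>S\<close> would stay in
  \<open>S\<close>, so vertices outside would be unreachable.\<close>

lemma (in pair_graph) exists_arc_leaving:
  assumes "Digraph_Component.connected (with_proj G)" "S \<subseteq> pverts G" "S \<noteq> {}" "S \<noteq> pverts G"
  shows "\<exists>u\<in>S. \<exists>w\<in>pverts G - S. (u, w) \<in> parcs G"
proof -
  obtain u v where uv: "u \<in> S" "v \<in> pverts G - S" using assms by blast
  have "(u, v) \<in> rtrancl_on (pverts G) (parcs (mk_symmetric (with_proj G)))"
    using assms(1,2) uv
    unfolding Digraph_Component.connected_def strongly_connected_def reachable_def by auto
  \<comment> \<open>\<open>G\<close> is symmetric, so the closure in the definition of connectedness
    adds no arcs.\<close>
  moreover have "parcs (mk_symmetric (with_proj G)) = parcs G"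
    using adj_mk_symmetric_eq sym_arcs by simp
  ultimately have "(u, v) \<in> rtrancl_on (pverts G) (parcs G)" by simp
  moreover have "\<not> (\<exists>u\<in>S. \<exists>w\<in>pverts G - S. (u, w) \<in> parcs G) \<Longrightarrow>
    (u, v) \<in> rtrancl_on (pverts G) (parcs G) \<Longrightarrow> v \<in> S"
    by (erule rtrancl_on_induct) (use uv in auto)
  ultimately show ?thesis using uv by blast
qed

text \<open>A new vertex \<open>w\<close> with a neighbour \<open>u\<close> in \<open>S\<close>
  inherits the label of \<open>u\<close>: only that fibre changes, it stays connected through the
  arc, and no new label appears. The size \<open>m\<close> is a parameter so that the lemma can both
  label the whole graph and grow a connected set of prescribed size.\<close>

lemma extend_connected_fibres:
  assumes "sym E" "finite V"
    and leave: "\<And>S. S \<subseteq> V \<Longrightarrow> S \<noteq> {} \<Longrightarrow> S \<noteq> V \<Longrightarrow> \<exists>u\<in>S. \<exists>w\<in>V - S. (u, w) \<in> E"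
    and S0: "S0 \<subseteq> V" "S0 \<noteq> {}" "\<And>i. i \<in> f0 ` S0 \<Longrightarrow> connected_in E {v \<in> S0. f0 v = i}"
    and m: "card S0 \<le> m" "m \<le> card V"
  shows "\<exists>S f. S0 \<subseteq> S \<and> S \<subseteq> V \<and> card S = m \<and> (\<forall>v\<in>S0. f v = f0 v) \<and> f ` S = f0 ` S0 \<and>
    (\<forall>i\<in>f ` S. connected_in E {v \<in> S. f v = i})"
  using m
proof (induction m rule: dec_induct)
  case base
  then show ?case using S0 by blast
next
  case (step m)
  then have "m \<le> card V" by simp
  with step.IH obtain S f
    where S: "S0 \<subseteq> S" "S \<subseteq> V" "card S = m" "\<forall>v\<in>S0. f v = f0 v" "f ` S = f0 ` S0"
      and conn: "\<forall>i\<in>f ` S. connected_in E {v \<in> S. f v = i}"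
    by blast
  have "S \<noteq> V" "S \<noteq> {}" using S step S0 by auto
  then obtain u w where uw: "u \<in> S" "w \<in> V - S" "(u, w) \<in> E"
    using leave S by meson
  let ?g = "f(w := f u)"
  have "connected_in E {v \<in> insert w S. ?g v = i}" if "i \<in> ?g ` insert w S" for i
  proof (cases "i = f u")
    case True
    have "connected_in E ({v \<in> S. f v = i} \<union> {w})"
      using uw conn True by (intro connected_in_Un[OF \<open>sym E\<close> _ connected_in_singleton _ _ uw(3)]) auto
    moreover have "{v \<in> insert w S. ?g v = i} = {v \<in> S. f v = i} \<union> {w}"
      using True uw by auto
    ultimately show ?thesis by simp
  next
    case False
    then have "{v \<in> insert w S. ?g v = i} = {v \<in> S. f v = i}" using uw by auto
    moreover have "i \<in> f ` S" using that False uw by (auto split: if_splits)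
    then have "connected_in E {v \<in> S. f v = i}" using conn by blast
    ultimately show ?thesis by simp
  qed
  moreover have "?g ` insert w S = f0 ` S0"
    unfolding S(5)[symmetric] using uw by (force simp: image_iff)
  moreover have "card (insert w S) = Suc m"
    using S uw finite_subset[OF S(2) \<open>finite V\<close>] by simp
  moreover have "?g v = f0 v" if "v \<in> S0" for v
    using S uw that by auto
  moreover have "insert w S \<subseteq> V" "S0 \<subseteq> insert w S"
    using S uw by auto
  ultimately show ?case
    by (intro exI[of _ "insert w S"] exI[of _ ?g] conjI ballI)
qed

section \<open>Long paths from large average degree\<close>

definition path_in :: "'a rel \<Rightarrow> 'a set \<Rightarrow> 'a list \<Rightarrow> bool" where
  "path_in E W xs \<longleftrightarrow> distinct xs \<and> set xs \<subseteq> W \<and> successively (\<lambda>u v. (u, v) \<in> E) xs"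

lemma exists_longest_path:
  assumes "path_in E W ys" "\<And>xs. path_in E W xs \<Longrightarrow> length xs \<le> t"
  obtains xs where "path_in E W xs" "\<And>ys. path_in E W ys \<Longrightarrow> length ys \<le> length xs"
proof -
  have "\<exists>xs. path_in E W xs \<and> (\<forall>ys. path_in E W ys \<longrightarrow> length ys \<le> length xs)"
    by (rule ex_has_greatest_nat[where k = ys and b = "Suc t"]) (use assms in \<open>auto simp: less_Suc_eq_le\<close>)
  then show thesis using that by blast
qed

text \<open>All neighbours in \<open>W\<close> of the first vertex of a longest path lie on that
  path, since another one could be prepended. There are at most \<open>t\<close> of them, so
  deleting this vertex destroys at most \<open>2 * t\<close> arcs, and induction on \<open>W\<close>
  applies.\<close>

lemma card_arcs_le_path_length:
  assumes "finite W" "sym E" "\<And>xs. path_in E W xs \<Longrightarrow> length xs \<le> t"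
  shows "card (E \<inter> W \<times> W) \<le> 2 * t * card W"
  using assms(1,3)
proof (induction W rule: finite_psubset_induct)
  case (psubset W)
  show ?case
  proof (cases "W = {}")
    case True
    then show ?thesis by simp
  next
    case False
    then obtain z where "z \<in> W" by auto
    then have z: "path_in E W [z]" by (simp add: path_in_def)
    obtain xs where xs: "path_in E W xs" and maxi: "\<And>ys. path_in E W ys \<Longrightarrow> length ys \<le> length xs"
      using exists_longest_path[OF z psubset.prems] by metis
    obtain x xs' where x: "xs = x # xs'"
      using maxi[OF z] by (cases xs) auto
    let ?N = "{y \<in> W. (x, y) \<in> E}"
    have "?N \<subseteq> set xs"
    proof (rule ccontr)
      assume "\<not> ?N \<subseteq> set xs"
      then obtain y where "y \<in> W" "(x, y) \<in> E" "y \<notin> set xs" by auto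
      then have "path_in E W (y # xs)"
        using xs x \<open>sym E\<close> by (auto simp: path_in_def dest: symD)
      then show False using maxi by fastforce
    qed
    then have N: "card ?N \<le> t"
      using card_mono[of "set xs" ?N] card_length[of xs] psubset.prems[OF xs] by simp
    let ?W = "W - {x}"
    have "x \<in> W" using xs x by (simp add: path_in_def)
    have IH: "card (E \<inter> ?W \<times> ?W) \<le> 2 * t * card ?W"
      using \<open>x \<in> W\<close> by (intro psubset.IH) (auto intro!: psubset.prems simp: path_in_def)
    \<comment> \<open>The arcs lost with \<open>x\<close> start or end at \<open>x\<close>; by
      symmetry of \<open>E\<close> their other end is in \<open>?N\<close> in both cases.\<close>
    have "E \<inter> W \<times> W \<subseteq> (E \<inter> ?W \<times> ?W) \<union> ({x} \<times> ?N \<union> ?N \<times> {x})"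
      using \<open>sym E\<close> by (auto dest: symD)
    then have "card (E \<inter> W \<times> W) \<le> card ((E \<inter> ?W \<times> ?W) \<union> ({x} \<times> ?N \<union> ?N \<times> {x}))"
      using psubset.hyps by (intro card_mono) auto
    also have "\<dots> \<le> card (E \<inter> ?W \<times> ?W) + (card ({x} \<times> ?N) + card (?N \<times> {x}))"
      by (meson add_left_mono card_Un_le le_trans)
    also have "\<dots> \<le> 2 * t * card ?W + 2 * t"
      using IH N by (simp add: card_cartesian_product)
    also have "\<dots> = 2 * t * card W"
      unfolding card.remove[OF \<open>finite W\<close> \<open>x \<in> W\<close>] by simp
    finally show ?thesis .
  qed
qed

text \<open>The number of edges is bounded by the number of arcs, at most \<open>2 * t\<close> per
  vertex; the factor 2 in the average degree turns this into \<open>4 * t\<close>.\<close>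

lemma (in pair_graph) average_degree_le_path_length:
  assumes "\<And>xs. path_in (parcs G) (pverts G) xs \<Longrightarrow> length xs \<le> t"
  shows "average_degree G \<le> 4 * real t"
proof (cases "card (pverts G) = 0")
  case True
  \<comment> \<open>Division by zero makes the average degree 0.\<close>
  then show ?thesis by (simp add: average_degree_def)
next
  case False
  have "edge_set G = (\<lambda>(u, v). {u, v}) ` parcs G"
    by (auto simp: edge_set_def)
  then have "card (edge_set G) \<le> card (parcs G)"
    by (simp add: card_image_le)
  also have "parcs G = parcs G \<inter> pverts G \<times> pverts G"
    using wellformed' by auto
  also have "card \<dots> \<le> 2 * t * card (pverts G)"
    using assms pair_sym_arcs by (intro card_arcs_le_path_length) (auto simp: symmetric_def)
  finally have "real (card (edge_set G)) \<le> real (2 * t * card (pverts G))"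
    by (rule of_nat_mono)
  then show ?thesis
    using False by (simp add: average_degree_def divide_simps mult_ac)
qed

section \<open>Ordered and sorted size vectors\<close>

text \<open>Reordering the sizes by a permutation \<open>p\<close> only renames the parts:
  \<open>V (p i)\<close> takes the place of \<open>V i\<close>.\<close>

lemma has_connected_partition_mset_eq:
  assumes "has_connected_partition G ns" "mset ms = mset ns"
  shows "has_connected_partition G ms"
proof -
  obtain V where sum: "sum_list ns = card (pverts G)"
    and V: "(\<Union>i<length ns. V i) = pverts G" "disjoint_family_on V {..<length ns}"
      "\<And>i. i < length ns \<Longrightarrow> card (V i) = ns ! i \<and> Digraph_Component.connected (with_proj G \<restriction> V i)"
    using assms(1) unfolding has_connected_partition_def by blast
  obtain p where p: "p permutes {..<length ns}" "permute_list p ns = ms"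
    using mset_eq_permutation[OF assms(2)] .
  have len: "length ms = length ns" using p(2) by auto
  have "sum_list ms = sum_list ns"
    using assms(2) by (metis sum_mset_sum_list)
  moreover have "(\<Union>i<length ms. V (p i)) = (\<Union>i\<in>p ` {..<length ns}. V i)"
    by (simp add: len)
  moreover have "disjoint_family_on (\<lambda>i. V (p i)) {..<length ms}"
    unfolding disjoint_family_on_def
  proof (intro ballI impI)
    fix i j assume "i \<in> {..<length ms}" "j \<in> {..<length ms}" "i \<noteq> j"
    then have "p i \<in> {..<length ns}" "p j \<in> {..<length ns}" "p i \<noteq> p j"
      using permutes_in_image[OF p(1)] permutes_inj[OF p(1)] len by (auto dest: injD)
    then show "V (p i) \<inter> V (p j) = {}"
      using V(2) unfolding disjoint_family_on_def by blast
  qed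
  moreover have "card (V (p i)) = ms ! i \<and> Digraph_Component.connected (with_proj G \<restriction> V (p i))"
    if "i < length ms" for i
  proof -
    have "p i < length ns" using that permutes_in_image[OF p(1)] len by auto
    moreover have "ms ! i = ns ! p i"
      using p that len permute_list_nth[OF p(1)] by auto
    ultimately show ?thesis using V(3) by simp
  qed
  ultimately show ?thesis
    unfolding has_connected_partition_def using sum V(1) permutes_image[OF p(1)]
    by (intro conjI exI[of _ "\<lambda>i. V (p i)"]) auto
qed

text \<open>Cutting along a path yields sizes in path order, so these unsorted vectors are what can
  be counted directly.\<close>

definition ordered_partition_sizes :: "'a pair_pre_digraph \<Rightarrow> nat \<Rightarrow> nat list set" where
  "ordered_partition_sizes G k =
     {ns. length ns = k \<and> (\<forall>x\<in>set ns. 1 \<le> x) \<and> has_connected_partition G ns}"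

lemma finite_ordered_partition_sizes: "finite (ordered_partition_sizes G k)"
proof (rule finite_subset)
  show "ordered_partition_sizes G k \<subseteq> {ns. set ns \<subseteq> {..card (pverts G)} \<and> length ns = k}"
    by (auto simp: ordered_partition_sizes_def has_connected_partition_def dest: member_le_sum_list)
  show "finite {ns. set ns \<subseteq> {..card (pverts G)} \<and> length ns = k}"
    by (simp add: finite_lists_length_eq)
qed

text \<open>Each ordered vector is obtained from its decreasing rearrangement, which is realised by
  the same parts, through one of \<open>fact k\<close> permutations.\<close>

lemma card_ordered_partition_sizes_le:
  "card (ordered_partition_sizes G k) \<le> fact k * num_partition_sizes G k"
proof -
  let ?D = "{ns. length ns = k \<and> sorted_wrt (\<ge>) ns \<and> (\<forall>x\<in>set ns. 1 \<le> x) \<and>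
    has_connected_partition G ns}"
  let ?P = "{p. p permutes {..<k}}"
  have fin: "finite ?D"
    by (rule finite_subset[OF _ finite_ordered_partition_sizes[of G k]])
       (auto simp: ordered_partition_sizes_def)
  have "ordered_partition_sizes G k \<subseteq> (\<lambda>(ds, p). permute_list p ds) ` (?D \<times> ?P)"
  proof
    fix ns assume ns: "ns \<in> ordered_partition_sizes G k"
    let ?ds = "rev (sort ns)"
    have m: "mset ns = mset ?ds" by simp
    obtain p where p: "p permutes {..<length ?ds}" "permute_list p ?ds = ns"
      using mset_eq_permutation[OF m] .
    have "?ds \<in> ?D"
      using ns has_connected_partition_mset_eq[of G ns ?ds]
      by (auto simp: ordered_partition_sizes_def sorted_wrt_rev)
    moreover have "p \<in> ?P" using p ns by (auto simp: ordered_partition_sizes_def)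
    ultimately show "ns \<in> (\<lambda>(ds, p). permute_list p ds) ` (?D \<times> ?P)"
      using p(2) by (intro image_eqI[of _ _ "(?ds, p)"]) auto
  qed
  then have "card (ordered_partition_sizes G k) \<le> card (?D \<times> ?P)"
    using fin by (intro surj_card_le) (auto simp: finite_permutations)
  also have "\<dots> = fact k * num_partition_sizes G k"
    by (simp add: card_cartesian_product card_permutations num_partition_sizes_def)
  finally show ?thesis .
qed

section \<open>Cutting a sequence of connected sets into blocks\<close>

text \<open>Encodes a division of \<open>{..<n}\<close> into \<open>k\<close> nonempty intervals
  \<open>{a i..<a (Suc i)}\<close>. Values beyond \<open>k\<close> are free, so two such functions
  are compared only up to \<open>k\<close>.\<close>

definition cut_sequence :: "nat \<Rightarrow> nat \<Rightarrow> (nat \<Rightarrow> nat) \<Rightarrow> bool" where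
  "cut_sequence n k a \<longleftrightarrow> a 0 = 0 \<and> a k = n \<and> (\<forall>i<k. a i < a (Suc i))"

lemma cut_sequence_mono:
  assumes "cut_sequence n k a" "i \<le> j" "j \<le> k"
  shows "a i \<le> a j"
  using assms(2,3)
proof (induction j rule: dec_induct)
  case (step m)
  then have "a m < a (Suc m)" using assms(1) by (simp add: cut_sequence_def)
  then show ?case using step by simp
qed simp

lemma cut_sequence_le: "cut_sequence n k a \<Longrightarrow> i \<le> k \<Longrightarrow> a i \<le> n"
  using cut_sequence_mono[of n k a i k] by (simp add: cut_sequence_def)

text \<open>Each part is the union of a run of consecutive fibres, connected through the links
  between neighbours. The fibres are indexed from 0 to \<open>L\<close>, hence a cut sequence of
  \<open>Suc L\<close>.\<close>

lemma has_connected_partition_cut: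
  assumes "pair_graph G"
    and conn: "\<And>i. i \<le> L \<Longrightarrow> connected_in (parcs G) (F i)"
    and link: "\<And>i. i < L \<Longrightarrow> \<exists>u\<in>F i. \<exists>w\<in>F (Suc i). (u, w) \<in> parcs G"
    and disj: "disjoint_family_on F {..L}"
    and cover: "(\<Union>i\<le>L. F i) = pverts G"
    and cut: "cut_sequence (Suc L) k a"
  shows "map (\<lambda>i. \<Sum>j\<in>{a i..<a (Suc i)}. card (F j)) [0..<k] \<in> ordered_partition_sizes G k"
proof -
  interpret pair_graph G by fact
  have sym: "sym (parcs G)" using pair_sym_arcs by (auto simp: symmetric_def)
  have fin: "finite (F i)" if "i \<le> L" for i
    using that cover pair_finite_verts by (metis UN_upper atMost_iff finite_subset)
  have a: "a 0 = 0" "a k = Suc L" "\<And>i. i < k \<Longrightarrow> a i < a (Suc i)"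
    using cut by (auto simp: cut_sequence_def)
  have aL: "a (Suc i) \<le> Suc L" if "i < k" for i
    using cut_sequence_le[OF cut] that by simp
  define V where "V i = (\<Union>j\<in>{a i..<a (Suc i)}. F j)" for i
  let ?ns = "map (\<lambda>i. \<Sum>j\<in>{a i..<a (Suc i)}. card (F j)) [0..<k]"
  have card_V: "card (V i) = ?ns ! i" if "i < k" for i
    unfolding V_def using aL[OF that] that fin disj
    by (subst card_UN_disjoint) (auto simp: disjoint_family_on_def)
  have conn_V: "connected_in (parcs G) (V i)" if "i < k" for i
    unfolding V_def using aL[OF that] by (intro connected_in_chain[OF sym a(3)[OF that]] conn link) auto
  \<comment> \<open>The first \<open>m\<close> parts use up exactly the fibres below the cut
    \<open>a m\<close>; \<open>m = k\<close> gives the covering property.\<close>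
  have blocks: "(\<Union>i<m. V i) = (\<Union>j<a m. F j)" if "m \<le> k" for m
    using that
  proof (induction m)
    case 0
    then show ?case by (simp add: a)
  next
    case (Suc m)
    have "{..<a (Suc m)} = {..<a m} \<union> {a m..<a (Suc m)}"
      using a(3)[of m] Suc.prems by auto
    then show ?case using Suc by (simp add: lessThan_Suc V_def Un_commute)
  qed
  have cover_V: "(\<Union>i<k. V i) = pverts G"
    using blocks[of k] cover by (simp add: a lessThan_Suc_atMost)
  have fin_V: "finite (V i)" if "i < k" for i
    using that cover_V pair_finite_verts by (metis UN_upper lessThan_iff finite_subset)
  have disj_V: "disjoint_family_on V {..<k}"
    unfolding disjoint_family_on_def
  proof (intro ballI impI)
    have *: "V i \<inter> V j = {}" if "i < j" "j < k" for i j
    proof -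
      have "a (Suc i) \<le> a j" using cut_sequence_mono[OF cut] that by simp
      moreover have "F l \<inter> F m = {}" if "l < m" "m \<le> L" for l m
        using that disj by (auto simp: disjoint_family_on_def)
      ultimately have "F l \<inter> F m = {}"
        if "l \<in> {a i..<a (Suc i)}" "m \<in> {a j..<a (Suc j)}" for l m
        using that aL[OF \<open>j < k\<close>] by simp
      then show ?thesis unfolding V_def by blast
    qed
    fix i j assume "i \<in> {..<k}" "j \<in> {..<k}" "i \<noteq> j"
    then show "V i \<inter> V j = {}"
      using *[of i j] *[of j i] by (cases i j rule: linorder_cases) auto
  qed
  have "sum_list ?ns = (\<Sum>i<k. card (V i))"
    using card_V by (simp add: interv_sum_list_conv_sum_set_nat atLeast0LessThan)
  also have "\<dots> = card (\<Union>i<k. V i)"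
    using disj_V fin_V by (intro card_UN_disjoint[symmetric]) (auto simp: disjoint_family_on_def)
  finally have "sum_list ?ns = card (pverts G)" using cover_V by simp
  then have "has_connected_partition G ?ns"
    unfolding has_connected_partition_def
    using cover_V disj_V card_V conn_V
    by (intro conjI exI[of _ V]) (auto intro: connected_induce_subgraph)
  moreover have "1 \<le> ?ns ! i" if "i < k" for i
  proof -
    have "V i \<noteq> {}" using conn_V[OF that] by (simp add: connected_in_def)
    then show ?thesis
      using card_V[OF that] fin_V[OF that] by (metis One_nat_def Suc_leI card_gt_0_iff)
  qed
  ultimately show ?thesis
    by (auto simp: ordered_partition_sizes_def)
qed

text \<open>The first \<open>i\<close> block sizes add up to the sum of \<open>s\<close> over
  \<open>{..<a i}\<close>. Since \<open>s\<close> is positive, such prefix sums grow strictly with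
  the endpoint and therefore determine \<open>a i\<close>.\<close>

lemma cut_sizes_inject:
  fixes s :: "nat \<Rightarrow> nat"
  assumes "\<And>i. i < n \<Longrightarrow> 0 < s i"
    and a: "cut_sequence n k a" and b: "cut_sequence n k b"
    and eq: "map (\<lambda>i. \<Sum>j\<in>{a i..<a (Suc i)}. s j) [0..<k] = map (\<lambda>i. \<Sum>j\<in>{b i..<b (Suc i)}. s j) [0..<k]"
    and "i \<le> k"
  shows "a i = b i"
proof -
  have prefix: "(\<Sum>j<c i. s j) = (\<Sum>l<i. \<Sum>j\<in>{c l..<c (Suc l)}. s j)"
    if "cut_sequence n k c" for c
    using \<open>i \<le> k\<close>
  proof (induction i)
    case 0
    then show ?case using that by (simp add: cut_sequence_def)
  next
    case (Suc i)
    have "c i < c (Suc i)" using that Suc.prems by (simp add: cut_sequence_def)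
    then have "{..<c (Suc i)} = {..<c i} \<union> {c i..<c (Suc i)}" by auto
    moreover have "(\<Sum>j\<in>{..<c i} \<union> {c i..<c (Suc i)}. s j) =
        (\<Sum>j<c i. s j) + (\<Sum>j\<in>{c i..<c (Suc i)}. s j)"
      by (rule sum.union_disjoint) auto
    ultimately have "(\<Sum>j<c (Suc i). s j) = (\<Sum>j<c i. s j) + (\<Sum>j\<in>{c i..<c (Suc i)}. s j)"
      by (rule ssubst)
    then show ?case using Suc by simp
  qed
  have "(\<Sum>j\<in>{a l..<a (Suc l)}. s j) = (\<Sum>j\<in>{b l..<b (Suc l)}. s j)" if "l < i" for l
    using arg_cong[OF eq, of "\<lambda>xs. xs ! l"] that \<open>i \<le> k\<close> by simp
  then have "(\<Sum>j<a i. s j) = (\<Sum>j<b i. s j)"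
    unfolding prefix[OF a] prefix[OF b] by (rule sum.cong[OF refl]) auto
  moreover have "(\<Sum>j<x. s j) < (\<Sum>j<y. s j)" if "x < y" "y \<le> n" for x y
    by (rule sum_strict_mono2[of _ _ x]) (use that assms(1) in auto)
  ultimately show ?thesis
    using cut_sequence_le[OF a \<open>i \<le> k\<close>] cut_sequence_le[OF b \<open>i \<le> k\<close>]
    by (cases "a i" "b i" rule: linorder_cases) fastforce+
qed

text \<open>The \<open>i\<close>-th cut is made at offset \<open>gs ! (i - 1)\<close> in the \<open>i\<close>-th block of length \<open>q\<close>.\<close>

definition block_cuts :: "nat \<Rightarrow> nat \<Rightarrow> nat \<Rightarrow> nat list \<Rightarrow> nat \<Rightarrow> nat" where
  "block_cuts n k q gs i =
     (if i = 0 then 0 else if i = k then n else Suc ((i - 1) * q + gs ! (i - 1)))"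

text \<open>The inner cut number \<open>i\<close> lies between \<open>(i - 1) * q + 1\<close> and
  \<open>i * q\<close>. These ranges are disjoint and increasing, the \<open>Suc\<close> keeps the
  first cut above 0, and the last inner cut is at most \<open>(k - 1) * q < n\<close>.\<close>

lemma cut_sequence_block_cuts:
  assumes "2 \<le> k" "(k - 1) * q < n" "length gs = k - 1" "set gs \<subseteq> {..<q}"
  shows "cut_sequence n k (block_cuts n k q gs)"
proof -
  have gs: "gs ! j < q" if "j < k - 1" for j
    using subsetD[OF assms(4) nth_mem[of j gs]] assms(3) that by simp
  have "block_cuts n k q gs i < block_cuts n k q gs (Suc i)" if "i < k" for i
  proof (cases i)
    case 0
    then show ?thesis using assms(1) by (simp add: block_cuts_def)
  next
    case (Suc j)
    have j: "j * q + gs ! j < Suc j * q" using gs[of j] that Suc by simp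
    show ?thesis
    proof (cases "Suc i = k")
      case True
      then have "k - 1 = Suc j" using Suc by simp
      then show ?thesis using True Suc j assms(2) by (simp add: block_cuts_def)
    next
      case False
      then show ?thesis using Suc j that by (simp add: block_cuts_def)
    qed
  qed
  then show ?thesis using assms(1) by (simp add: cut_sequence_def block_cuts_def)
qed

section \<open>Counting the cuts along a path\<close>

text \<open>Each path vertex is labelled by its position and the labelling is extended to all
  vertices. The fibre of \<open>i\<close> contains \<open>xs ! i\<close>, so the arcs of the path
  link consecutive fibres.\<close>

lemma (in pair_graph) connected_fibres_of_path:
  assumes "Digraph_Component.connected (with_proj G)"
    and path: "path_in (parcs G) (pverts G) xs" and len: "length xs = Suc L"
  obtains F where "\<And>i. i \<le> L \<Longrightarrow> connected_in (parcs G) (F i)"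
    "\<And>i. i < L \<Longrightarrow> \<exists>u\<in>F i. \<exists>w\<in>F (Suc i). (u, w) \<in> parcs G"
    "disjoint_family_on F {..L}" "(\<Union>i\<le>L. F i) = pverts G"
proof -
  have sym: "sym (parcs G)" using pair_sym_arcs by (auto simp: symmetric_def)
  define f0 where "f0 = the_inv_into {..<length xs} ((!) xs)"
  have inj: "inj_on ((!) xs) {..<length xs}"
    using path by (auto simp: path_in_def inj_on_nth)
  have f0: "f0 (xs ! i) = i" if "i \<le> L" for i
    using that len the_inv_into_f_f[OF inj] by (simp add: f0_def)
  have set_xs: "set xs = (!) xs ` {..L}"
    using len by (auto simp: set_conv_nth image_iff less_Suc_eq_le)
  have im: "f0 ` set xs = {..L}"
    using f0 by (force simp: set_xs image_image)
  have single: "{v \<in> set xs. f0 v = i} = {xs ! i}" if "i \<le> L" for i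
    using that f0 by (auto simp: set_xs)
  have sub: "set xs \<subseteq> pverts G" using path by (simp add: path_in_def)
  have le: "card (set xs) \<le> card (pverts G)"
    using sub pair_finite_verts by (rule card_mono[rotated])
  \<comment> \<open>Taking the full cardinality for \<open>m\<close> forces
    \<open>S = pverts G\<close>.\<close>
  have "\<exists>S f. set xs \<subseteq> S \<and> S \<subseteq> pverts G \<and> card S = card (pverts G) \<and>
    (\<forall>v\<in>set xs. f v = f0 v) \<and> f ` S = f0 ` set xs \<and>
    (\<forall>i\<in>f ` S. connected_in (parcs G) {v \<in> S. f v = i})"
    by (rule extend_connected_fibres[OF sym pair_finite_verts exists_arc_leaving[OF assms(1)] sub])
       (use len le im single connected_in_singleton in auto)
  then obtain f where f: "\<forall>v\<in>set xs. f v = f0 v" "f ` pverts G = {..L}"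
    "\<forall>i\<le>L. connected_in (parcs G) {v \<in> pverts G. f v = i}"
    using card_subset_eq[OF pair_finite_verts] im by (metis atMost_iff)
  show ?thesis
  proof (rule that[of "\<lambda>i. {v \<in> pverts G. f v = i}"])
    fix i assume "i < L"
    then have "(xs ! i, xs ! Suc i) \<in> parcs G"
      using path len by (auto simp: path_in_def successively_conv_nth)
    moreover have "xs ! j \<in> {v \<in> pverts G. f v = j}" if "j \<le> L" for j
      using that f(1) f0 sub len by auto
    ultimately show "\<exists>u\<in>{v \<in> pverts G. f v = i}. \<exists>w\<in>{v \<in> pverts G. f v = Suc i}. (u, w) \<in> parcs G"
      using \<open>i < L\<close> by (meson Suc_leI less_imp_le)
  qed (use f in \<open>auto simp: disjoint_family_on_def\<close>)
qed

text \<open>The \<open>k - 1\<close> inner cuts choose their offsets below \<open>q\<close>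
  independently, and the resulting size vectors are distinct because they determine the
  cuts.\<close>

lemma (in pair_graph) power_le_card_ordered_partition_sizes:
  assumes conn: "Digraph_Component.connected (with_proj G)" and k: "2 \<le> k"
    and path: "path_in (parcs G) (pverts G) xs" and q: "(k - 1) * q < length xs"
  shows "q ^ (k - 1) \<le> card (ordered_partition_sizes G k)"
proof -
  obtain L where len: "length xs = Suc L" using q by (cases "length xs") auto
  obtain F where F: "\<And>i. i \<le> L \<Longrightarrow> connected_in (parcs G) (F i)"
    "\<And>i. i < L \<Longrightarrow> \<exists>u\<in>F i. \<exists>w\<in>F (Suc i). (u, w) \<in> parcs G"
    "disjoint_family_on F {..L}" "(\<Union>i\<le>L. F i) = pverts G"
    using connected_fibres_of_path[OF conn path len] by blast
  let ?A = "{gs. set gs \<subseteq> {..<q} \<and> length gs = k - 1}"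
  let ?cut = "block_cuts (Suc L) k q"
  let ?sizes = "\<lambda>gs. map (\<lambda>i. \<Sum>j\<in>{?cut gs i..<?cut gs (Suc i)}. card (F j)) [0..<k]"
  have cut: "cut_sequence (Suc L) k (?cut gs)" if "gs \<in> ?A" for gs
    using that k q len by (intro cut_sequence_block_cuts) auto
  have pos: "0 < card (F i)" if "i < Suc L" for i
  proof -
    have "finite (F i)" using F(4) that pair_finite_verts
      by (metis UN_upper atMost_iff finite_subset less_Suc_eq_le)
    moreover have "F i \<noteq> {}" using F(1)[of i] that by (simp add: connected_in_def)
    ultimately show ?thesis by (simp add: card_gt_0_iff)
  qed
  have "inj_on ?sizes ?A"
  proof (rule inj_onI)
    fix gs hs assume A: "gs \<in> ?A" "hs \<in> ?A" and eq: "?sizes gs = ?sizes hs"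
    have "gs ! j = hs ! j" if "j < k - 1" for j
    proof -
      \<comment> \<open>The index \<open>Suc j\<close> is neither 0 nor \<open>k\<close>, so
        \<open>block_cuts\<close> takes its last branch and the offset can be read off.\<close>
      have "Suc j \<le> k" "Suc j \<noteq> k" using that by auto
      then show ?thesis
        using cut_sizes_inject[OF pos cut[OF A(1)] cut[OF A(2)] eq, of "Suc j"]
        by (simp add: block_cuts_def)
    qed
    then show "gs = hs" using A by (auto intro: nth_equalityI)
  qed
  moreover have "?sizes ` ?A \<subseteq> ordered_partition_sizes G k"
  proof (rule image_subsetI)
    fix gs assume "gs \<in> ?A"
    then show "?sizes gs \<in> ordered_partition_sizes G k"
      by (intro has_connected_partition_cut[OF pair_graph F cut])
  qed
  ultimately have "card ?A \<le> card (ordered_partition_sizes G k)"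
    by (intro card_inj_on_le) (auto simp: finite_ordered_partition_sizes)
  then show ?thesis by (simp add: card_lists_length_eq)
qed

text \<open>One connected set of all but \<open>k - 1\<close> vertices, together with the remaining
  vertices as singletons, is a suitable partition. This covers the case where the longest path is
  too short to be cut by blocks.\<close>

lemma (in pair_graph) ordered_partition_sizes_nonempty:
  assumes conn: "Digraph_Component.connected (with_proj G)" and k: "1 \<le> k" "k \<le> card (pverts G)"
  shows "ordered_partition_sizes G k \<noteq> {}"
proof -
  let ?n = "card (pverts G)"
  have sym: "sym (parcs G)" using pair_sym_arcs by (auto simp: symmetric_def)
  obtain x where x: "x \<in> pverts G" using k by fastforce
  \<comment> \<open>With the single label 0, the whole grown set is one fibre and hence
    connected.\<close>
  have "\<exists>S f. {x} \<subseteq> S \<and> S \<subseteq> pverts G \<and> card S = ?n - (k - 1) \<and> (\<forall>v\<in>{x}. f v = (0::nat)) \<and>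
    f ` S = (\<lambda>_. 0) ` {x} \<and> (\<forall>i\<in>f ` S. connected_in (parcs G) {v \<in> S. f v = i})"
    by (rule extend_connected_fibres[OF sym pair_finite_verts exists_arc_leaving[OF conn]])
       (use x k connected_in_singleton in auto)
  then obtain S f where S: "x \<in> S" "S \<subseteq> pverts G" "card S = ?n - (k - 1)" "f ` S = {0::nat}"
    "connected_in (parcs G) {v \<in> S. f v = 0}" by auto
  have "{v \<in> S. f v = 0} = S" using S(4) by auto
  then have conn_S: "connected_in (parcs G) S" using S(5) by simp
  obtain ys where ys: "set ys = pverts G - S" "distinct ys"
    using finite_distinct_list pair_finite_verts by blast
  have len: "length ys = k - 1"
    using distinct_card[OF ys(2)] ys(1) S(2,3) k pair_finite_verts
    by (simp add: card_Diff_subset finite_subset)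
  let ?ns = "(?n - (k - 1)) # replicate (k - 1) 1"
  let ?V = "\<lambda>i. if i = 0 then S else {ys ! (i - 1)}"
  have idx: "{..<k} = insert 0 (Suc ` {..<k - 1})"
    using k by (cases k) (auto simp: lessThan_Suc_eq_insert_0)
  have "(\<Union>i<length ?ns. ?V i) = S \<union> (!) ys ` {..<length ys}"
    using k by (auto simp: idx len)
  also have "\<dots> = pverts G" using ys(1) S(2) by (auto simp: set_conv_nth)
  finally have cover: "(\<Union>i<length ?ns. ?V i) = pverts G" .
  have yS: "ys ! i \<notin> S" if "i < k - 1" for i
    using that ys(1) len nth_mem[of i ys] by auto
  have "disjoint_family_on ?V {..<k}"
    unfolding disjoint_family_on_def idx
    using yS ys(2) len by (auto simp: nth_eq_iff_index_eq)
  then have disj: "disjoint_family_on ?V {..<length ?ns}" using k by simp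
  have "card (?V i) = ?ns ! i \<and> Digraph_Component.connected (with_proj G \<restriction> ?V i)"
    if "i < length ?ns" for i
    using that S(3) conn_S connected_in_singleton
    by (cases i) (auto intro!: connected_induce_subgraph)
  then have "has_connected_partition G ?ns"
    unfolding has_connected_partition_def using cover disj k
    by (intro conjI exI[of _ ?V]) (auto simp: sum_list_replicate)
  then have "?ns \<in> ordered_partition_sizes G k"
    using k by (auto simp: ordered_partition_sizes_def)
  then show ?thesis by auto
qed

section \<open>The bound in terms of the average degree\<close>

lemma (in pair_graph) average_degree_power_le:
  assumes conn: "Digraph_Component.connected (with_proj G)" and k: "2 \<le> k" "k \<le> card (pverts G)"
  shows "average_degree G ^ (k - 1) \<le> (8 * real (k - 1)) ^ (k - 1) * fact k * num_partition_sizes G k"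
proof -
  let ?P = "path_in (parcs G) (pverts G)"
  have "length xs \<le> card (pverts G)" if "?P xs" for xs
    using that pair_finite_verts card_mono[of "pverts G" "set xs"] distinct_card[of xs]
    by (simp add: path_in_def)
  moreover have "?P []" by (simp add: path_in_def)
  ultimately obtain xs where xs: "?P xs" and maxi: "\<And>ys. ?P ys \<Longrightarrow> length ys \<le> length xs"
    using exists_longest_path by metis
  \<comment> \<open>The largest block length with \<open>(k - 1) * q < length xs\<close>, for a
    nonempty longest path.\<close>
  define q where "q = (length xs - 1) div (k - 1)"
  \<comment> \<open>If \<open>q = 0\<close>, the count by blocks is vacuous and the existence of one
    partition gives the bound with \<open>r = 1\<close>.\<close>
  define r where "r = max 1 q"
  obtain x where "x \<in> pverts G" using k by fastforce
  then have pos: "length xs \<ge> 1" using maxi[of "[x]"] by (simp add: path_in_def)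
  have "(k - 1) * q \<le> length xs - 1" by (simp add: q_def)
  then have "(k - 1) * q < length xs" using pos by linarith
  then have "q ^ (k - 1) \<le> card (ordered_partition_sizes G k)"
    by (rule power_le_card_ordered_partition_sizes[OF conn k(1) xs])
  moreover have "1 \<le> card (ordered_partition_sizes G k)"
    using ordered_partition_sizes_nonempty[OF conn _ k(2)] k(1) finite_ordered_partition_sizes[of G k]
    by (simp add: Suc_le_eq card_gt_0_iff)
  ultimately have "r ^ (k - 1) \<le> card (ordered_partition_sizes G k)"
    by (simp add: r_def max_def)
  then have r: "r ^ (k - 1) \<le> fact k * num_partition_sizes G k"
    using card_ordered_partition_sizes_le[of G k] by (rule order_trans)
  have "length xs - 1 < (k - 1) * Suc q"
    unfolding q_def mult_Suc_right using k(1) by (intro dividend_less_times_div) simp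
  then have "length xs \<le> (k - 1) * Suc q" by linarith
  \<comment> \<open>Here \<open>Suc q \<le> 2 * r\<close>; with the factor 4 from the path bound
    this yields the constant 8.\<close>
  also have "\<dots> \<le> (k - 1) * (2 * r)" by (rule mult_le_mono2) (simp add: r_def)
  finally have "real (length xs) \<le> real ((k - 1) * (2 * r))" by (rule of_nat_mono)
  then have "4 * real (length xs) \<le> 8 * real (k - 1) * real r"
    by (simp only: of_nat_mult of_nat_numeral)
  then have "average_degree G \<le> 8 * real (k - 1) * real r"
    using average_degree_le_path_length[OF maxi] by (rule order_trans[rotated])
  moreover have "0 \<le> average_degree G" by (simp add: average_degree_def)
  ultimately have "average_degree G ^ (k - 1) \<le> (8 * real (k - 1) * real r) ^ (k - 1)"
    by (rule power_mono)
  also have "\<dots> = (8 * real (k - 1)) ^ (k - 1) * real (r ^ (k - 1))"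
    by (simp only: power_mult_distrib of_nat_power)
  also have "\<dots> \<le> (8 * real (k - 1)) ^ (k - 1) * real (fact k * num_partition_sizes G k)"
    by (rule mult_left_mono[OF of_nat_mono[OF r]]) simp
  finally show ?thesis by (simp only: of_nat_mult of_nat_fact mult.assoc)
qed

text \<open>The constant \<open>c\<close> is chosen before \<open>G\<close>, which expresses the
  dependence on \<open>k\<close> alone. With fewer than \<open>k\<close> vertices no partition into
  \<open>k\<close> nonempty parts exists, while the average degree may be positive; hence the
  assumption on \<open>card (pverts G)\<close>.\<close>

theorem theorem8:
  fixes k :: nat
  assumes "k \<ge> 2"
  shows "\<exists>c::real. c > 0 \<and>
    (\<forall>G :: 'a pair_pre_digraph.
       pair_graph G \<and> Digraph_Component.connected (with_proj G) \<and> card (pverts G) \<ge> k \<longrightarrow>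
       real (num_partition_sizes G k) \<ge> c * average_degree G ^ (k - 1))"
proof -
  let ?C = "(8 * real (k - 1)) ^ (k - 1) * fact k"
  have C: "0 < ?C" using assms by simp
  show ?thesis
  proof (intro exI[of _ "1 / ?C"] conjI allI impI)
    show "0 < 1 / ?C" using C by simp
    fix G :: "'a pair_pre_digraph"
    assume "pair_graph G \<and> Digraph_Component.connected (with_proj G) \<and> card (pverts G) \<ge> k"
    then have "average_degree G ^ (k - 1) \<le> ?C * num_partition_sizes G k"
      using pair_graph.average_degree_power_le assms by blast
    then show "real (num_partition_sizes G k) \<ge> 1 / ?C * average_degree G ^ (k - 1)"
      using C by (simp add: pos_divide_le_eq mult.commute)
  qed
qed

end
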